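(* Let $(X,d_X)$ and $(Y,d_Y)$ be non-empty metric spaces, and equip $X\times Y$ with the metric $d_{X\times Y}((x_1,y_1),(x_2,y_2))=\max\{d_X(x_1,x_2),d_Y(y_1,y_2)\}$ (and $X^n$ with the analogous maximum metric). Then \[ \dim_{\mathrm L} X+\dim_{\mathrm L} Y\leq \dim_{\mathrm L}(X\times Y)\leq \dim_{\mathrm L} X+\dim_{\mathrm A} Y\leq \dim_{\mathrm A}(X\times Y)\leq \dim_{\mathrm A} X+\dim_{\mathrm A} Y, \] and, for every integer $n\geq 1$, \[ \dim_{\mathrm L}(X^n)=n\,\dim_{\mathrm L} X . \]
   Context: For a non-empty subset $F$ of a metric space and $r>0$, $N_r(F)$ denotes the smallest number of open sets of diameter at most $r$ needed to cover $F$ (possibly $\infty$). $B(x,R)$ is the closed ball of centre $x$ and radius $R$. The Assouad dimension is \[ \dim_{\mathrm A}F=\inf\Big\{\alpha:\ \exists\, C,\rho>0 \text{ such that for all } 0<r<R\leq\rho,\ \sup_{x\in F}N_r(B(x,R)\cap F)\leq C (R/r)^{\alpha}\Big\}, \] and the lower dimension is \[ \dim_{\mathrm L}F=\sup\Big\{\alpha:\ \exists\, C,\rho>0 \text{ such that for all } 0<r<R\leq\rho,\ \inf_{x\in F}N_r(B(x,R)\cap F)\geq C (R/r)^{\alpha}\Big\}. \] Both take values in $[0,\infty]$; a metric space $X$ is regarded as a subset of itself. *)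

theory Defs
  imports "HOL-Analysis.Analysis"
begin

context Metric_space
begin

text \<open>
  Valued in \<^typ>\<open>ennreal\<close>, so that an unbounded set has diameter infinity and
  the empty set has diameter 0.
\<close>
definition ediam :: "'a set \<Rightarrow> ennreal" where
  "ediam U = (SUP (x, y) \<in> U \<times> U. ennreal (d x y))"

text \<open>
  The number N_r(F), with the sets of the cover open in the ambient space;
  the infimum of the empty set in \<^typ>\<open>enat\<close> is infinity.
\<close>
definition cover_num :: "real \<Rightarrow> 'a set \<Rightarrow> enat" where
  "cover_num r F =
     (INF \<U> \<in> {\<U>. finite \<U> \<and> (\<forall>U\<in>\<U>. openin mtopology U \<and> ediam U \<le> ennreal r) \<and> F \<subseteq> \<Union>\<U>}.
        enat (card \<U>))"

text \<open>
  The exponent ranges over all reals. For nonempty \<open>F\<close> negative exponents never qualify in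
  the first definition, while every nonpositive exponent qualifies in the second, so both
  values lie between 0 and infinity.
\<close>
definition assouad_dim :: "'a set \<Rightarrow> ereal" where
  "assouad_dim F = Inf (ereal ` {\<alpha>. \<exists>C>0. \<exists>\<rho>>0. \<forall>r R. 0 < r \<and> r < R \<and> R \<le> \<rho> \<longrightarrow>
      ereal_of_enat (SUP x\<in>F. cover_num r (mcball x R \<inter> F)) \<le> ereal (C * (R / r) powr \<alpha>)})"

definition lower_dim :: "'a set \<Rightarrow> ereal" where
  "lower_dim F = Sup (ereal ` {\<alpha>. \<exists>C>0. \<exists>\<rho>>0. \<forall>r R. 0 < r \<and> r < R \<and> R \<le> \<rho> \<longrightarrow>
      ereal_of_enat (INF x\<in>F. cover_num r (mcball x R \<inter> F)) \<ge> ereal (C * (R / r) powr \<alpha>)})"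

end

definition max_dist :: "('a \<Rightarrow> 'a \<Rightarrow> real) \<Rightarrow> ('b \<Rightarrow> 'b \<Rightarrow> real) \<Rightarrow> 'a \<times> 'b \<Rightarrow> 'a \<times> 'b \<Rightarrow> real" where
  "max_dist d1 d2 = (\<lambda>(x1, y1) (x2, y2). max (d1 x1 x2) (d2 y1 y2))"

text \<open>
  The \<open>n\<close>-fold power of \<open>M\<close> is modelled by the extensional functions from \<open>{..<n}\<close> to \<open>M\<close>.
\<close>
definition mpow :: "'a set \<Rightarrow> nat \<Rightarrow> (nat \<Rightarrow> 'a) set" where
  "mpow M n = {..<n} \<rightarrow>\<^sub>E M"

text \<open>Intended for \<open>n \<ge> 1\<close> only, as the maximum is taken over the indices below \<open>n\<close>.\<close>
definition pow_dist :: "('a \<Rightarrow> 'a \<Rightarrow> real) \<Rightarrow> nat \<Rightarrow> (nat \<Rightarrow> 'a) \<Rightarrow> (nat \<Rightarrow> 'a) \<Rightarrow> real" where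
  "pow_dist d n f g = Max ((\<lambda>i. d (f i) (g i)) ` {..<n})"

lemma Metric_space_max_dist:
  assumes "Metric_space M1 d1" "Metric_space M2 d2"
  shows "Metric_space (M1 \<times> M2) (max_dist d1 d2)"
proof -
  interpret A: Metric_space M1 d1 by fact
  interpret B: Metric_space M2 d2 by fact
  show ?thesis
  proof
    fix x y show "0 \<le> max_dist d1 d2 x y"
      by (auto simp: max_dist_def le_max_iff_disj split: prod.split)
    show "max_dist d1 d2 x y = max_dist d1 d2 y x"
      by (auto simp: max_dist_def A.commute B.commute split: prod.split)
  next
    fix x y assume "x \<in> M1 \<times> M2" "y \<in> M1 \<times> M2"
    then obtain a b a' b' where *: "x = (a,b)" "y = (a',b')" "a \<in> M1" "a' \<in> M1" "b \<in> M2" "b' \<in> M2"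
      by auto
    have "max (d1 a a') (d2 b b') = 0 \<longleftrightarrow> d1 a a' = 0 \<and> d2 b b' = 0"
      using A.nonneg[of a a'] B.nonneg[of b b'] by linarith
    then show "(max_dist d1 d2 x y = 0) = (x = y)"
      using * by (simp add: max_dist_def)
  next
    fix x y z assume "x \<in> M1 \<times> M2" "y \<in> M1 \<times> M2" "z \<in> M1 \<times> M2"
    then obtain a b a' b' a'' b'' where *: "x = (a,b)" "y = (a',b')" "z = (a'',b'')"
       "a \<in> M1" "a' \<in> M1" "a'' \<in> M1" "b \<in> M2" "b' \<in> M2" "b'' \<in> M2"
      by auto
    have "d1 a a'' \<le> d1 a a' + d1 a' a''" "d2 b b'' \<le> d2 b b' + d2 b' b''"
      using * A.triangle B.triangle by auto
    then show "max_dist d1 d2 x z \<le> max_dist d1 d2 x y + max_dist d1 d2 y z"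
      unfolding max_dist_def * prod.case by linarith
  qed
qed

lemma Metric_space_pow_dist:
  assumes "Metric_space M d" "n \<ge> 1"
  shows "Metric_space (mpow M n) (pow_dist d n)"
proof -
  interpret Metric_space M d by fact
  have ne: "{..<n} \<noteq> {}" using assms(2) by (simp add: lessThan_empty_iff)
  have le: "pow_dist d n f g \<le> c \<longleftrightarrow> (\<forall>i<n. d (f i) (g i) \<le> c)" for f g c
    using ne by (auto simp: pow_dist_def)
  have comp: "d (f i) (g i) \<le> pow_dist d n f g" if "i < n" for f g i
    using that le by blast
  show ?thesis
  proof
    fix f g 
    show nn: "0 \<le> pow_dist d n f g"
      using comp[of 0 f g] nonneg[of "f 0" "g 0"] assms(2) by linarith
    show "pow_dist d n f g = pow_dist d n g f"
      by (simp add: pow_dist_def commute)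
  next
    fix f g assume fg: "f \<in> mpow M n" "g \<in> mpow M n"
    have "0 \<le> pow_dist d n f g"
      using comp[of 0 f g] nonneg[of "f 0" "g 0"] assms(2) by linarith
    then have "pow_dist d n f g = 0 \<longleftrightarrow> pow_dist d n f g \<le> 0" by linarith
    also have "\<dots> \<longleftrightarrow> (\<forall>i<n. f i = g i)"
      unfolding le using fg
      by (metis PiE_mem lessThan_iff mpow_def nonneg order_antisym_conv order_refl zero)
    also have "\<dots> \<longleftrightarrow> f = g"
      using fg unfolding mpow_def by (metis PiE_ext lessThan_iff)
    finally show "(pow_dist d n f g = 0) = (f = g)" .
  next
    fix f g h assume fgh: "f \<in> mpow M n" "g \<in> mpow M n" "h \<in> mpow M n"
    show "pow_dist d n f h \<le> pow_dist d n f g + pow_dist d n g h"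
      unfolding le
    proof safe
      fix i assume i: "i < n"
      have "d (f i) (h i) \<le> d (f i) (g i) + d (g i) (h i)"
        using fgh i by (intro triangle) (auto simp: mpow_def)
      then show "d (f i) (h i) \<le> pow_dist d n f g + pow_dist d n g h"
        using comp[OF i, of f g] comp[OF i, of g h] by linarith
    qed
  qed
qed

end

theory Submission
  imports Defs
begin

text \<open>
  Everything follows from how covering numbers behave under products with the maximum metric.
  A ball of the product is the product of balls of the same radius, and boxes built from covers
  of the factors cover the product, so
  \[ N_r(F \times G) \le N_r(F)\, N_r(G). \]
  A matching lower bound comes from separated sets: points at mutual distance greater than
  \<open>r\<close> lie in different sets of any cover by sets of diameter at most \<open>r\<close>, a greedy choice
  yields \<open>k\<close> such points whenever \<open>k \<le> N\<^sub>4\<^sub>r(F)\<close>, and products of separated sets are separated. Hence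
  \[ N_{4r}(F)\, N_{4r}(G) \le N_r(F \times G). \]
  The loss of the factor 4 in the scale only changes the constant in the definitions of the
  dimensions.

  Call a real number a lower (or Assouad) exponent if it belongs to the set whose supremum
  (or infimum) defines the dimension, and write \<open>\<lesssim>\<close> for inequality up to a positive
  constant factor. The two displayed inequalities say that exponents can be
  added and subtracted, for example: if \<open>\<gamma>\<close> is a lower exponent of \<open>X \<times> Y\<close> and \<open>\<beta>\<close> an
  Assouad exponent of \<open>Y\<close>, then dividing \<open>(R/r)\<^sup>\<gamma> \<lesssim> N\<^sub>r(B\<^sub>X) N\<^sub>r(B\<^sub>Y)\<close> by
  \<open>N\<^sub>r(B\<^sub>Y) \<lesssim> (R/r)\<^sup>\<beta>\<close> shows that \<open>\<gamma> - \<beta>\<close> is a lower exponent of \<open>X\<close>. Taking suprema and infima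
  gives the four inequalities.

  For powers the same two bounds hold with \<open>n\<close> factors. The upper bound is strong enough
  there because a power contains the balls around constant functions, which are the powers of
  balls of \<open>X\<close>: a lower exponent \<open>\<gamma>\<close> of the power satisfies \<open>(R/r)\<^sup>\<gamma> \<lesssim> N\<^sub>r(B(x,R))\<^sup>n\<close>
  for every \<open>x\<close>, and an \<open>n\<close>-th root can be taken.
\<close>

section \<open>Extended natural numbers and exponents\<close>

lemma ereal_le_of_enat_iff: "ereal c \<le> ereal_of_enat N \<longleftrightarrow> enat (nat \<lceil>c\<rceil>) \<le> N"
  by (cases N) (simp_all add: ceiling_le_iff nat_le_iff)

text \<open>
  The factors may be infinite while the separated sets that will witness \<open>k\<close> and \<open>l\<close> are
  finite; this rule lets finite witnesses of unbounded size stand for an infinite factor.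
\<close>
lemma enat_mult_leI:
  assumes "\<And>k l. enat k \<le> a \<Longrightarrow> enat l \<le> b \<Longrightarrow> enat (k * l) \<le> c"
  shows "a * b \<le> c"
proof -
  have inf: "c = \<infinity>" if "\<And>k. enat k \<le> c"
    using that by (metis Suc_n_not_le_n enat.exhaust enat_ord_simps(1) not_infinity_eq)
  show ?thesis
  proof (cases a)
    case (enat k)
    note a = this
    show ?thesis
    proof (cases b)
      case (enat l)
      then show ?thesis using assms[of k l] a by simp
    next
      case infinity
      show ?thesis
      proof (cases "k = 0")
        case False
        have "enat l \<le> c" for l
          using assms[of k l] a infinity False
          by (metis One_nat_def enat_ord_simps(1) enat_ord_simps(3) le_cases less_one linorder_not_less
              mult_le_mono1 nat_mult_1 order_trans)
        then show ?thesis using inf by simp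
      qed (simp add: a zero_enat_def[symmetric])
    qed
  next
    case infinity
    note a = this
    show ?thesis
    proof (cases "b = 0")
      case False
      then have "enat 1 \<le> b" by (metis ileI1 one_eSuc one_enat_def zero_less_iff_neq_zero)
      then have "enat k \<le> c" for k
        using assms[of k 1] a by simp
      then show ?thesis using inf by simp
    qed (simp add: a)
  qed
qed

text \<open>
  The dimensions are suprema and infima over real exponents in the extended reals, so adding
  or subtracting exponents has to be transferred to sums of possibly infinite dimensions.
\<close>

lemma Sup_add_Sup_le:
  fixes A B G :: "real set"
  assumes "0 \<in> A" "0 \<in> B" "\<And>a b. a \<in> A \<Longrightarrow> b \<in> B \<Longrightarrow> a + b \<in> G"
  shows "Sup (ereal ` A) + Sup (ereal ` B) \<le> Sup (ereal ` G)"
proof -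
  have "Sup (ereal ` A) + Sup (ereal ` B) = (SUP a\<in>A. ereal a + Sup (ereal ` B))"
    using assms(1,2) by (subst SUP_ereal_add_left) (auto dest: SUP_upper2[of 0 B 0 ereal])
  also have "\<dots> = (SUP a\<in>A. SUP b\<in>B. ereal a + ereal b)"
    using assms(2) by (intro SUP_cong refl) (subst SUP_ereal_add_right, auto)
  also have "\<dots> \<le> Sup (ereal ` G)"
    using assms(3) by (intro SUP_least) (auto intro: SUP_upper)
  finally show ?thesis .
qed

text \<open>
  An infinite supremum of \<open>A\<close> makes the right-hand side infinite, and \<open>0 \<in> A\<close> excludes
  \<open>-\<infinity>\<close>, so only a finite supremum, which can be subtracted, has to be treated.
\<close>
lemma Sup_le_Sup_add_Inf:
  fixes A B G :: "real set"
  assumes "0 \<in> A" "\<And>g b. g \<in> G \<Longrightarrow> b \<in> B \<Longrightarrow> g - b \<in> A"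
  shows "Sup (ereal ` G) \<le> Sup (ereal ` A) + Inf (ereal ` B)"
proof (rule SUP_least)
  fix g assume g: "g \<in> G"
  have ne: "Sup (ereal ` A) \<noteq> -\<infinity>"
    using SUP_upper[OF assms(1), of ereal] by auto
  show "ereal g \<le> Sup (ereal ` A) + Inf (ereal ` B)"
  proof (cases "Sup (ereal ` A)")
    case (real s)
    have "ereal g - ereal s \<le> Inf (ereal ` B)"
    proof (rule INF_greatest)
      fix b assume "b \<in> B"
      then have "ereal (g - b) \<le> Sup (ereal ` A)"
        using assms(2) g by (intro SUP_upper) auto
      then show "ereal g - ereal s \<le> ereal b"
        using real by simp
    qed
    then show ?thesis using real by (cases "Inf (ereal ` B)") auto
  qed (use ne in auto)
qed

text \<open>
  Once \<open>G\<close> has an element, taking \<open>a = 0\<close> puts it into \<open>B\<close>, and with nonnegativity the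
  infimum of \<open>B\<close> is a real number that can be moved to the other side. Without a lower bound
  it could be \<open>-\<infinity>\<close>, and its sum with an infinite supremum is \<open>\<infinity>\<close>.
\<close>
lemma Sup_add_Inf_le_Inf:
  fixes A B G :: "real set"
  assumes "0 \<in> A" "\<And>b. b \<in> B \<Longrightarrow> 0 \<le> b" "\<And>g a. g \<in> G \<Longrightarrow> a \<in> A \<Longrightarrow> g - a \<in> B"
  shows "Sup (ereal ` A) + Inf (ereal ` B) \<le> Inf (ereal ` G)"
proof (rule INF_greatest)
  fix g assume g: "g \<in> G"
  have "Inf (ereal ` B) \<le> ereal g"
    using assms(3)[OF g assms(1)] by (auto intro: INF_lower2)
  moreover have "0 \<le> Inf (ereal ` B)"
    using assms(2) by (auto intro: INF_greatest)
  ultimately obtain i where i: "Inf (ereal ` B) = ereal i"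
    by (cases "Inf (ereal ` B)") auto
  have "Sup (ereal ` A) \<le> ereal (g - i)"
  proof (rule SUP_least)
    fix a assume "a \<in> A"
    then have "Inf (ereal ` B) \<le> ereal (g - a)"
      using assms(3)[OF g] by (intro INF_lower) auto
    then show "ereal a \<le> ereal (g - i)" using i by simp
  qed
  then show "Sup (ereal ` A) + Inf (ereal ` B) \<le> ereal g"
    using i by (cases "Sup (ereal ` A)") auto
qed

lemma Inf_le_Inf_add_Inf:
  fixes A B G :: "real set"
  assumes "\<And>a. a \<in> A \<Longrightarrow> 0 \<le> a" "\<And>b. b \<in> B \<Longrightarrow> 0 \<le> b" "\<And>a b. a \<in> A \<Longrightarrow> b \<in> B \<Longrightarrow> a + b \<in> G"
  shows "Inf (ereal ` G) \<le> Inf (ereal ` A) + Inf (ereal ` B)"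
proof (cases "A = {} \<or> B = {}")
  case True
  then show ?thesis by (auto simp: top_ereal_def)
next
  case False
  have ge: "0 \<le> Inf (ereal ` B)"
    using assms(2) by (auto intro: INF_greatest)
  have "Inf (ereal ` A) + Inf (ereal ` B) = (INF a\<in>A. ereal a + Inf (ereal ` B))"
    using False ge assms(1) by (subst INF_ereal_add_left) auto
  also have "\<dots> = (INF a\<in>A. INF b\<in>B. ereal a + ereal b)"
    using False assms(2) by (intro INF_cong refl) (subst INF_ereal_add_right, auto)
  also have "Inf (ereal ` G) \<le> \<dots>"
    using assms(3) by (intro INF_greatest) (auto intro: INF_lower)
  finally show ?thesis .
qed

lemma Sup_eq_mult_Sup:
  fixes A G :: "real set" and c :: real
  assumes "c > 0" "\<And>a. a \<in> A \<Longrightarrow> c * a \<in> G" "\<And>g. g \<in> G \<Longrightarrow> g / c \<in> A"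
  shows "Sup (ereal ` G) = ereal c * Sup (ereal ` A)"
proof (rule antisym)
  show "Sup (ereal ` G) \<le> ereal c * Sup (ereal ` A)"
  proof (rule SUP_least)
    fix g assume "g \<in> G"
    then have "ereal c * ereal (g / c) \<le> ereal c * Sup (ereal ` A)"
      using assms by (intro ereal_mult_left_mono SUP_upper) auto
    then show "ereal g \<le> ereal c * Sup (ereal ` A)"
      using assms(1) by simp
  qed
next
  have "Sup (ereal ` A) \<le> Sup (ereal ` G) / ereal c"
  proof (rule SUP_least)
    fix a assume "a \<in> A"
    then have "ereal (c * a) \<le> Sup (ereal ` G)"
      using assms by (intro SUP_upper) auto
    then show "ereal a \<le> Sup (ereal ` G) / ereal c"
      using assms(1) by (simp add: ereal_le_divide_pos)
  qed
  then show "ereal c * Sup (ereal ` A) \<le> Sup (ereal ` G)"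
    using assms(1) by (simp add: ereal_le_divide_pos)
qed

section \<open>Covering numbers and separated sets\<close>

context Metric_space
begin

definition fine_cover :: "real \<Rightarrow> 'a set \<Rightarrow> 'a set set \<Rightarrow> bool" where
  "fine_cover r F \<U> \<longleftrightarrow> finite \<U> \<and> F \<subseteq> \<Union>\<U> \<and>
     (\<forall>U\<in>\<U>. openin mtopology U \<and> (\<forall>x\<in>U. \<forall>y\<in>U. d x y \<le> r))"

definition separated :: "real \<Rightarrow> 'a set \<Rightarrow> bool" where
  "separated r S \<longleftrightarrow> (\<forall>x\<in>S. \<forall>y\<in>S. x \<noteq> y \<longrightarrow> r < d x y)"

lemma ediam_le_iff: "0 \<le> r \<Longrightarrow> ediam U \<le> ennreal r \<longleftrightarrow> (\<forall>x\<in>U. \<forall>y\<in>U. d x y \<le> r)"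
  by (auto simp: ediam_def SUP_le_iff ennreal_le_iff)

lemma cover_num_le_iff:
  assumes "0 \<le> r"
  shows "cover_num r F \<le> enat k \<longleftrightarrow> (\<exists>\<U>. fine_cover r F \<U> \<and> card \<U> \<le> k)"
proof -
  have eq: "cover_num r F = (INF \<U>\<in>{\<U>. fine_cover r F \<U>}. enat (card \<U>))"
    unfolding cover_num_def fine_cover_def using assms
    by (intro INF_cong) (auto simp: ediam_le_iff)
  show ?thesis
  proof
    assume le: "cover_num r F \<le> enat k"
    have "(\<lambda>\<U>. enat (card \<U>)) ` {\<U>. fine_cover r F \<U>} \<noteq> {}"
    proof
      assume "(\<lambda>\<U>. enat (card \<U>)) ` {\<U>. fine_cover r F \<U>} = {}"
      then have "cover_num r F = \<infinity>"
        unfolding eq by (simp only: Inf_empty top_enat_def)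
      then show False using le by simp
    qed
    then have "cover_num r F \<in> (\<lambda>\<U>. enat (card \<U>)) ` {\<U>. fine_cover r F \<U>}"
      unfolding eq Inf_enat_def by (auto intro: LeastI)
    then show "\<exists>\<U>. fine_cover r F \<U> \<and> card \<U> \<le> k"
      using le by auto
  next
    assume "\<exists>\<U>. fine_cover r F \<U> \<and> card \<U> \<le> k"
    then show "cover_num r F \<le> enat k"
      unfolding eq by (auto intro: INF_lower2)
  qed
qed

text \<open>
  Mapping each point to a member of the cover containing it is injective, because a member
  has diameter at most \<open>r\<close>.
\<close>
lemma card_separated_le_cover_num:
  assumes "0 \<le> r" "S \<subseteq> F" "finite S" "separated r S"
  shows "enat (card S) \<le> cover_num r F"
proof (cases "cover_num r F")
  case (enat k)
  then obtain \<U> where \<U>: "fine_cover r F \<U>" "card \<U> \<le> k"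
    using cover_num_le_iff[OF assms(1), of F k] by auto
  have "\<exists>U\<in>\<U>. x \<in> U" if "x \<in> S" for x
    using \<U>(1) assms(2) that unfolding fine_cover_def by auto
  then obtain f where f: "\<And>x. x \<in> S \<Longrightarrow> f x \<in> \<U> \<and> x \<in> f x"
    by metis
  have "inj_on f S"
  proof (rule inj_onI, rule ccontr)
    fix x y assume *: "x \<in> S" "y \<in> S" "f x = f y" "x \<noteq> y"
    then have "d x y \<le> r"
      using f[of x] f[of y] \<U>(1) unfolding fine_cover_def by auto
    then show False
      using assms(4) * unfolding separated_def by force
  qed
  then have "card S \<le> card \<U>"
    using f \<U>(1) by (intro card_inj_on_le[of f]) (auto simp: fine_cover_def)
  then show ?thesis using \<U>(2) enat by simp
qed simp

lemma one_le_cover_num: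
  assumes "0 \<le> r" "F \<noteq> {}"
  shows "enat 1 \<le> cover_num r F"
proof -
  obtain x where "x \<in> F" using assms(2) by auto
  then show ?thesis
    using card_separated_le_cover_num[OF assms(1), of "{x}" F] by (simp add: separated_def)
qed

text \<open>
  Greedy choice: fewer than \<open>k\<close> open balls of radius \<open>2 * r\<close>, whose diameter is at most
  \<open>4 * r\<close>, cannot cover \<open>F\<close>, so a point far from all the previous ones remains.
\<close>
lemma separated_subset_exists:
  assumes "0 < r" "F \<subseteq> M" "enat k \<le> cover_num (4 * r) F"
  shows "\<exists>S\<subseteq>F. finite S \<and> card S = k \<and> separated r S"
  using assms(3)
proof (induction k)
  case 0
  then show ?case by (intro exI[of _ "{}"]) (auto simp: separated_def)
next
  case (Suc k)
  then have lt: "enat k < cover_num (4 * r) F" by (simp add: Suc_ile_eq)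
  then obtain S where S: "S \<subseteq> F" "finite S" "card S = k" "separated r S"
    using Suc.IH less_imp_le[OF lt] by blast
  let ?\<U> = "(\<lambda>x. mball x (2 * r)) ` S"
  have small: "d y z \<le> 4 * r" if "y \<in> mball x (2 * r)" "z \<in> mball x (2 * r)" for x y z
    using that triangle[of y x z] commute[of x y] by auto
  have "card ?\<U> \<le> k" using S card_image_le by blast
  then have "\<not> fine_cover (4 * r) F ?\<U>"
    using cover_num_le_iff[of "4 * r" F k] lt assms(1) by auto
  moreover have "\<forall>U\<in>?\<U>. openin mtopology U \<and> (\<forall>x\<in>U. \<forall>y\<in>U. d x y \<le> 4 * r)"
    using small by blast
  ultimately obtain x where x: "x \<in> F" "x \<notin> \<Union>?\<U>"
    using S(2) unfolding fine_cover_def by blast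
  have far: "r < d x y" "r < d y x" if "y \<in> S" for y
  proof -
    have "2 * r \<le> d y x"
      using x that S(1) assms(2) by force
    then show "r < d x y" "r < d y x"
      using assms(1) commute[of x y] by auto
  qed
  have "x \<in> M" using x assms(2) by auto
  then have "x \<notin> S"
    using far[of x] assms(1) by auto
  then show ?case
    using S x far by (intro exI[of _ "insert x S"]) (auto simp: separated_def)
qed

section \<open>Lower and Assouad exponents\<close>

definition lower_exponent :: "real \<Rightarrow> bool" where
  "lower_exponent \<alpha> \<longleftrightarrow> (\<exists>C>0. \<exists>\<rho>>0. \<forall>r R. 0 < r \<and> r < R \<and> R \<le> \<rho> \<longrightarrow>
     (\<forall>x\<in>M. ereal (C * (R / r) powr \<alpha>) \<le> ereal_of_enat (cover_num r (mcball x R))))"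

definition assouad_exponent :: "real \<Rightarrow> bool" where
  "assouad_exponent \<alpha> \<longleftrightarrow> (\<exists>C>0. \<exists>\<rho>>0. \<forall>r R. 0 < r \<and> r < R \<and> R \<le> \<rho> \<longrightarrow>
     (\<forall>x\<in>M. ereal_of_enat (cover_num r (mcball x R)) \<le> ereal (C * (R / r) powr \<alpha>)))"

lemma mcball_Int_carrier: "mcball x R \<inter> M = mcball x R"
  by auto

lemma lower_dim_eq: "lower_dim M = Sup (ereal ` {\<alpha>. lower_exponent \<alpha>})"
  unfolding lower_dim_def lower_exponent_def mcball_Int_carrier
  by (simp only: ereal_le_of_enat_iff le_INF_iff)

lemma assouad_dim_eq: "M \<noteq> {} \<Longrightarrow> assouad_dim M = Inf (ereal ` {\<alpha>. assouad_exponent \<alpha>})"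
  unfolding assouad_dim_def assouad_exponent_def mcball_Int_carrier
  by (simp only: ereal_of_enat_SUP SUP_le_iff simp_thms)

lemma lower_exponentE:
  assumes "lower_exponent \<alpha>"
  obtains C \<rho> where "C > 0" "\<rho> > 0" "\<And>r R x. 0 < r \<Longrightarrow> r < R \<Longrightarrow> R \<le> \<rho> \<Longrightarrow> x \<in> M \<Longrightarrow>
     ereal (C * (R / r) powr \<alpha>) \<le> ereal_of_enat (cover_num r (mcball x R))"
  using assms unfolding lower_exponent_def by blast

lemma assouad_exponentE:
  assumes "assouad_exponent \<alpha>"
  obtains C \<rho> where "C > 0" "\<rho> > 0" "\<And>r R x. 0 < r \<Longrightarrow> r < R \<Longrightarrow> R \<le> \<rho> \<Longrightarrow> x \<in> M \<Longrightarrow>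
     ereal_of_enat (cover_num r (mcball x R)) \<le> ereal (C * (R / r) powr \<alpha>)"
  using assms unfolding assouad_exponent_def by blast

lemma one_le_cover_num_mcball:
  assumes "x \<in> M" "0 \<le> r" "0 \<le> R"
  shows "1 \<le> ereal_of_enat (cover_num r (mcball x R))"
proof -
  have "enat 1 \<le> cover_num r (mcball x R)"
    using assms by (intro one_le_cover_num) (auto simp: mcball_eq_empty)
  then have "ereal_of_enat (enat 1) \<le> ereal_of_enat (cover_num r (mcball x R))"
    by (simp only: ereal_of_enat_le_iff)
  then show ?thesis unfolding one_ereal_def by simp
qed

lemma lower_exponent_0: "lower_exponent 0"
  unfolding lower_exponent_def
  by (intro exI[of _ 1] conjI allI impI ballI) (use one_le_cover_num_mcball in \<open>auto simp flip: one_ereal_def\<close>)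

text \<open>
  Letting \<open>r\<close> tend to 0 with \<open>R\<close> fixed, a negative exponent would force covering numbers
  below 1.
\<close>
lemma assouad_exponent_nonneg:
  assumes "assouad_exponent \<alpha>" "M \<noteq> {}"
  shows "0 \<le> \<alpha>"
proof (rule ccontr)
  assume "\<not> 0 \<le> \<alpha>"
  then have "\<alpha> < 0" by simp
  from assms(1) obtain C \<rho> where C: "C > 0" "\<rho> > 0"
    and bound: "\<And>r R x. 0 < r \<Longrightarrow> r < R \<Longrightarrow> R \<le> \<rho> \<Longrightarrow> x \<in> M \<Longrightarrow>
      ereal_of_enat (cover_num r (mcball x R)) \<le> ereal (C * (R / r) powr \<alpha>)"
    by (rule assouad_exponentE) blast
  obtain x where x: "x \<in> M" using assms(2) by auto
  have "((\<lambda>t. C * t powr \<alpha>) \<longlongrightarrow> C * 0) at_top"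
    by (intro tendsto_intros tendsto_neg_powr \<open>\<alpha> < 0\<close> filterlim_ident)
  then have "eventually (\<lambda>t. C * t powr \<alpha> < 1) at_top"
    by (rule order_tendstoD) simp
  then have "eventually (\<lambda>t. C * t powr \<alpha> < 1 \<and> t > 1) at_top"
    by (intro eventually_conj eventually_gt_at_top)
  then obtain t where t: "C * t powr \<alpha> < 1" "t > 1"
    using eventually_happens by fastforce
  have "\<rho> / t < \<rho>" using t C by (simp add: divide_less_eq)
  then have "1 \<le> ereal (C * (\<rho> / (\<rho> / t)) powr \<alpha>)"
    using t C x by (intro order_trans[OF one_le_cover_num_mcball bound]) auto
  then show False using t C by simp
qed

text \<open>
  The factor 4 lost by passing to separated sets is harmless: it is absorbed by the constant
  when \<open>4 * r < R\<close>, and otherwise \<open>R / r\<close> is bounded and covering numbers are at least 1.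
\<close>
lemma lower_exponentI_scaled:
  assumes C: "C > 0" and \<rho>: "\<rho> > 0"
    and bound: "\<And>r R x. 0 < r \<Longrightarrow> 4 * r < R \<Longrightarrow> R \<le> \<rho> \<Longrightarrow> x \<in> M \<Longrightarrow>
      ereal (C * (R / (4 * r)) powr \<alpha>) \<le> ereal_of_enat (cover_num r (mcball x R))"
  shows "lower_exponent \<alpha>"
proof -
  \<comment> \<open>The first entry serves the scales with \<open>4 * r < R\<close>, the second those with \<open>R / r \<le> 4\<close>.\<close>
  define C' where "C' = min (C * (1 / 4) powr \<alpha>) (4 powr (- \<bar>\<alpha>\<bar>))"
  have "C' > 0" using C by (simp add: C'_def)
  moreover have "ereal (C' * (R / r) powr \<alpha>) \<le> ereal_of_enat (cover_num r (mcball x R))"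
    if "0 < r" "r < R" "R \<le> \<rho>" "x \<in> M" for r R x
  proof (cases "4 * r < R")
    case True
    have "C' * (R / r) powr \<alpha> \<le> (C * (1 / 4) powr \<alpha>) * (R / r) powr \<alpha>"
      by (intro mult_right_mono) (auto simp: C'_def)
    also have "\<dots> = C * ((1 / 4) * (R / r)) powr \<alpha>"
      using that by (simp only: powr_mult mult.assoc)
    also have "\<dots> = C * (R / (4 * r)) powr \<alpha>"
      by simp
    finally show ?thesis
      using bound[OF that(1) True that(3,4)] by (meson ereal_less_eq(3) order_trans)
  next
    case False
    have "(R / r) powr \<alpha> \<le> (R / r) powr \<bar>\<alpha>\<bar>"
      using that by (intro powr_mono) auto
    also have "\<dots> \<le> 4 powr \<bar>\<alpha>\<bar>"
      using that False by (intro powr_mono2) (auto simp: field_simps)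
    finally have "C' * (R / r) powr \<alpha> \<le> 4 powr (- \<bar>\<alpha>\<bar>) * 4 powr \<bar>\<alpha>\<bar>"
      using \<open>C' > 0\<close> by (intro mult_mono) (auto simp: C'_def)
    also have "\<dots> = 1" by (simp flip: powr_add)
    finally have "ereal (C' * (R / r) powr \<alpha>) \<le> 1" by simp
    also have "\<dots> \<le> ereal_of_enat (cover_num r (mcball x R))"
      using that by (intro one_le_cover_num_mcball) auto
    finally show ?thesis .
  qed
  ultimately show ?thesis
    unfolding lower_exponent_def using \<rho> by blast
qed

end

section \<open>Products of two spaces\<close>

sublocale Metric_space12 \<subseteq> maxprod: Metric_space "M1 \<times> M2" "max_dist d1 d2"
  by (intro Metric_space_max_dist M1.Metric_space_axioms M2.Metric_space_axioms)

context Metric_space12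
begin

lemma max_dist_Pair: "max_dist d1 d2 (x, y) (x', y') = max (d1 x x') (d2 y y')"
  by (simp add: max_dist_def)

lemma mcball_max_dist: "maxprod.mcball (x, y) R = M1.mcball x R \<times> M2.mcball y R"
  by (auto simp: max_dist_Pair)

lemma openin_max_dist_Times:
  assumes "openin M1.mtopology U" "openin M2.mtopology V"
  shows "openin maxprod.mtopology (U \<times> V)"
  unfolding maxprod.openin_mtopology
proof (intro conjI allI impI)
  show "U \<times> V \<subseteq> M1 \<times> M2"
    using assms M1.openin_mtopology M2.openin_mtopology by blast
  fix z assume "z \<in> U \<times> V"
  then obtain x y where z: "z = (x, y)" "x \<in> U" "y \<in> V" by auto
  obtain r s where "r > 0" "s > 0" "M1.mball x r \<subseteq> U" "M2.mball y s \<subseteq> V"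
    using assms z M1.openin_mtopology M2.openin_mtopology by meson
  then have "min r s > 0" "maxprod.mball z (min r s) \<subseteq> U \<times> V"
    using z by (auto simp: max_dist_Pair subset_iff)
  then show "\<exists>r>0. maxprod.mball z r \<subseteq> U \<times> V" by blast
qed

lemma cover_num_Times_le:
  assumes "0 \<le> r" "F \<noteq> {}" "G \<noteq> {}"
  shows "maxprod.cover_num r (F \<times> G) \<le> M1.cover_num r F * M2.cover_num r G"
proof -
  have pos: "M1.cover_num r F \<noteq> 0" "M2.cover_num r G \<noteq> 0"
    using M1.one_le_cover_num[of r F] M2.one_le_cover_num[of r G] assms
    by (auto simp: zero_enat_def)
  show ?thesis
  proof (cases "M1.cover_num r F = \<infinity> \<or> M2.cover_num r G = \<infinity>")
    case True
    then have "M1.cover_num r F * M2.cover_num r G = \<infinity>"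
      using pos by (auto simp: imult_is_infinity)
    then show ?thesis by simp
  next
    case False
    then obtain k l where kl: "M1.cover_num r F = enat k" "M2.cover_num r G = enat l"
      by auto
    obtain \<U> where \<U>: "M1.fine_cover r F \<U>" "card \<U> \<le> k"
      using M1.cover_num_le_iff[OF assms(1), of F k] kl by auto
    obtain \<V> where \<V>: "M2.fine_cover r G \<V>" "card \<V> \<le> l"
      using M2.cover_num_le_iff[OF assms(1), of G l] kl by auto
    have fin: "finite (\<U> \<times> \<V>)"
      using \<U>(1) \<V>(1) unfolding M1.fine_cover_def M2.fine_cover_def by blast
    have cover: "F \<subseteq> \<Union>\<U>" "G \<subseteq> \<Union>\<V>"
      using \<U>(1) \<V>(1) unfolding M1.fine_cover_def M2.fine_cover_def by blast+
    have U: "openin M1.mtopology U" "\<And>x y. x \<in> U \<Longrightarrow> y \<in> U \<Longrightarrow> d1 x y \<le> r" if "U \<in> \<U>" for U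
      using \<U>(1) that unfolding M1.fine_cover_def by blast+
    have V: "openin M2.mtopology V" "\<And>x y. x \<in> V \<Longrightarrow> y \<in> V \<Longrightarrow> d2 x y \<le> r" if "V \<in> \<V>" for V
      using \<V>(1) that unfolding M2.fine_cover_def by blast+
    let ?\<W> = "(\<lambda>(U, V). U \<times> V) ` (\<U> \<times> \<V>)"
    have "maxprod.fine_cover r (F \<times> G) ?\<W>"
      unfolding maxprod.fine_cover_def
    proof (intro conjI ballI)
      show "finite ?\<W>"
        using fin by (rule finite_imageI)
      show "F \<times> G \<subseteq> \<Union>?\<W>"
      proof
        fix z assume "z \<in> F \<times> G"
        then obtain U V where "U \<in> \<U>" "V \<in> \<V>" "z \<in> U \<times> V"
          using cover by blast
        then show "z \<in> \<Union>?\<W>" by blast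
      qed
    next
      fix W assume "W \<in> ?\<W>"
      then obtain U V where W: "U \<in> \<U>" "V \<in> \<V>" "W = U \<times> V" by auto
      show "openin maxprod.mtopology W"
        using W U(1) V(1) openin_max_dist_Times by simp
      fix x y assume "x \<in> W" "y \<in> W"
      then show "max_dist d1 d2 x y \<le> r"
        using W U(2) V(2) by (auto simp: max_dist_Pair)
    qed
    moreover have "card ?\<W> \<le> k * l"
    proof -
      have "card ?\<W> \<le> card (\<U> \<times> \<V>)"
        using fin by (rule card_image_le)
      also have "\<dots> \<le> k * l"
        using \<U> \<V> by (simp add: card_cartesian_product mult_le_mono)
      finally show ?thesis .
    qed
    ultimately show ?thesis
      using maxprod.cover_num_le_iff[OF assms(1), of "F \<times> G" "k * l"] kl by auto
  qed
qed

lemma cover_num_Times_ge: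
  assumes "0 < r" "F \<subseteq> M1" "G \<subseteq> M2"
  shows "M1.cover_num (4 * r) F * M2.cover_num (4 * r) G \<le> maxprod.cover_num r (F \<times> G)"
proof (rule enat_mult_leI)
  fix k l assume kl: "enat k \<le> M1.cover_num (4 * r) F" "enat l \<le> M2.cover_num (4 * r) G"
  obtain S where S: "S \<subseteq> F" "finite S" "card S = k" "M1.separated r S"
    using M1.separated_subset_exists[OF assms(1,2) kl(1)] by auto
  obtain T where T: "T \<subseteq> G" "finite T" "card T = l" "M2.separated r T"
    using M2.separated_subset_exists[OF assms(1,3) kl(2)] by auto
  have "maxprod.separated r (S \<times> T)"
    using S(4) T(4) unfolding maxprod.separated_def M1.separated_def M2.separated_def
    by (auto simp: max_dist_def less_max_iff_disj)
  then show "enat (k * l) \<le> maxprod.cover_num r (F \<times> G)"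
    using maxprod.card_separated_le_cover_num[of r "S \<times> T" "F \<times> G"] assms S T
    by (auto simp: card_cartesian_product)
qed

lemma cover_num_mcball_le:
  assumes "0 < r" "0 < R" "x \<in> M1" "y \<in> M2"
  shows "ereal_of_enat (maxprod.cover_num r (maxprod.mcball (x, y) R))
    \<le> ereal_of_enat (M1.cover_num r (M1.mcball x R)) * ereal_of_enat (M2.cover_num r (M2.mcball y R))"
  unfolding mcball_max_dist ereal_of_enat_mult[symmetric] ereal_of_enat_le_iff
  using assms by (intro cover_num_Times_le) (auto simp: M1.mcball_eq_empty M2.mcball_eq_empty)

lemma cover_num_mcball_ge:
  assumes "0 < r"
  shows "ereal_of_enat (M1.cover_num (4 * r) (M1.mcball x R))
      * ereal_of_enat (M2.cover_num (4 * r) (M2.mcball y R))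
    \<le> ereal_of_enat (maxprod.cover_num r (maxprod.mcball (x, y) R))"
  unfolding mcball_max_dist ereal_of_enat_mult[symmetric] ereal_of_enat_le_iff
  using assms by (intro cover_num_Times_ge) auto

lemma lower_exponent_add:
  assumes "M1.lower_exponent \<alpha>" "M2.lower_exponent \<beta>"
  shows "maxprod.lower_exponent (\<alpha> + \<beta>)"
proof -
  from assms(1) obtain C \<rho> where C: "C > 0" "\<rho> > 0"
    and X: "\<And>r R x. 0 < r \<Longrightarrow> r < R \<Longrightarrow> R \<le> \<rho> \<Longrightarrow> x \<in> M1 \<Longrightarrow>
      ereal (C * (R / r) powr \<alpha>) \<le> ereal_of_enat (M1.cover_num r (M1.mcball x R))"
    by (rule M1.lower_exponentE) blast
  from assms(2) obtain D \<sigma> where D: "D > 0" "\<sigma> > 0"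
    and Y: "\<And>r R y. 0 < r \<Longrightarrow> r < R \<Longrightarrow> R \<le> \<sigma> \<Longrightarrow> y \<in> M2 \<Longrightarrow>
      ereal (D * (R / r) powr \<beta>) \<le> ereal_of_enat (M2.cover_num r (M2.mcball y R))"
    by (rule M2.lower_exponentE) blast
  show ?thesis
  proof (rule maxprod.lower_exponentI_scaled)
    show "C * D > 0" "min \<rho> \<sigma> > 0" using C D by auto
    fix r R z assume r: "0 < r" "4 * r < R" "R \<le> min \<rho> \<sigma>" and "z \<in> M1 \<times> M2"
    then obtain x y where z: "z = (x, y)" "x \<in> M1" "y \<in> M2" by auto
    have "ereal (C * D * (R / (4 * r)) powr (\<alpha> + \<beta>))
        = ereal (C * (R / (4 * r)) powr \<alpha>) * ereal (D * (R / (4 * r)) powr \<beta>)"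
      by (simp add: powr_add)
    also have "\<dots> \<le> ereal_of_enat (M1.cover_num (4 * r) (M1.mcball x R))
        * ereal_of_enat (M2.cover_num (4 * r) (M2.mcball y R))"
      using r z C D by (intro ereal_mult_mono X Y) (auto simp: ereal_of_enat_nonneg)
    also have "\<dots> \<le> ereal_of_enat (maxprod.cover_num r (maxprod.mcball z R))"
      unfolding z using r by (intro cover_num_mcball_ge)
    finally show "ereal (C * D * (R / (4 * r)) powr (\<alpha> + \<beta>))
        \<le> ereal_of_enat (maxprod.cover_num r (maxprod.mcball z R))" .
  qed
qed

text \<open>
  One centre \<open>y\<close> suffices, since the Assouad bound for the second factor holds at every
  centre; the ball around \<open>(x, y)\<close> is large, the ball around \<open>y\<close> small, so the ball around
  \<open>x\<close> must supply the quotient.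
\<close>
lemma lower_exponent_diff:
  assumes "maxprod.lower_exponent \<gamma>" "M2.assouad_exponent \<beta>" "M2 \<noteq> {}"
  shows "M1.lower_exponent (\<gamma> - \<beta>)"
proof -
  from assms(1) obtain C \<rho> where C: "C > 0" "\<rho> > 0"
    and XY: "\<And>r R z. 0 < r \<Longrightarrow> r < R \<Longrightarrow> R \<le> \<rho> \<Longrightarrow> z \<in> M1 \<times> M2 \<Longrightarrow>
      ereal (C * (R / r) powr \<gamma>) \<le> ereal_of_enat (maxprod.cover_num r (maxprod.mcball z R))"
    by (rule maxprod.lower_exponentE) blast
  from assms(2) obtain D \<sigma> where D: "D > 0" "\<sigma> > 0"
    and Y: "\<And>r R y. 0 < r \<Longrightarrow> r < R \<Longrightarrow> R \<le> \<sigma> \<Longrightarrow> y \<in> M2 \<Longrightarrow>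
      ereal_of_enat (M2.cover_num r (M2.mcball y R)) \<le> ereal (D * (R / r) powr \<beta>)"
    by (rule M2.assouad_exponentE) blast
  obtain y where y: "y \<in> M2" using assms(3) by auto
  have "ereal (C / D * (R / r) powr (\<gamma> - \<beta>)) \<le> ereal_of_enat (M1.cover_num r (M1.mcball x R))"
    if r: "0 < r" "r < R" "R \<le> min \<rho> \<sigma>" and x: "x \<in> M1" for r R x
  proof -
    define b where "b = D * (R / r) powr \<beta>"
    have b: "b > 0" using D r by (simp add: b_def)
    have "ereal (C * (R / r) powr \<gamma>) \<le> ereal_of_enat (maxprod.cover_num r (maxprod.mcball (x, y) R))"
      using XY r x y by simp
    also have "\<dots> \<le> ereal_of_enat (M1.cover_num r (M1.mcball x R))
        * ereal_of_enat (M2.cover_num r (M2.mcball y R))"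
      using r x y by (intro cover_num_mcball_le) auto
    also have "\<dots> \<le> ereal_of_enat (M1.cover_num r (M1.mcball x R)) * ereal b"
      unfolding b_def using r y by (intro ereal_mult_left_mono Y) (auto simp: ereal_of_enat_nonneg)
    finally have "ereal (C * (R / r) powr \<gamma> / b) \<le> ereal_of_enat (M1.cover_num r (M1.mcball x R))"
      using b by (cases "M1.cover_num r (M1.mcball x R)") (auto simp: pos_divide_le_eq)
    then show ?thesis
      by (simp add: b_def powr_diff)
  qed
  then show ?thesis
    unfolding M1.lower_exponent_def using C D
    by (intro exI[of _ "C / D"] exI[of _ "min \<rho> \<sigma>"] conjI allI impI ballI) auto
qed

text \<open>
  As before, with the roles of large and small exchanged. Here the lower bound for the product
  enters, so the product is covered at scale \<open>r / 4\<close>, which costs a factor \<open>4 powr \<gamma>\<close>.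
\<close>
lemma assouad_exponent_diff:
  assumes "maxprod.assouad_exponent \<gamma>" "M1.lower_exponent \<alpha>" "M1 \<noteq> {}"
  shows "M2.assouad_exponent (\<gamma> - \<alpha>)"
proof -
  from assms(1) obtain C \<rho> where C: "C > 0" "\<rho> > 0"
    and XY: "\<And>r R z. 0 < r \<Longrightarrow> r < R \<Longrightarrow> R \<le> \<rho> \<Longrightarrow> z \<in> M1 \<times> M2 \<Longrightarrow>
      ereal_of_enat (maxprod.cover_num r (maxprod.mcball z R)) \<le> ereal (C * (R / r) powr \<gamma>)"
    by (rule maxprod.assouad_exponentE) blast
  from assms(2) obtain D \<sigma> where D: "D > 0" "\<sigma> > 0"
    and X: "\<And>r R x. 0 < r \<Longrightarrow> r < R \<Longrightarrow> R \<le> \<sigma> \<Longrightarrow> x \<in> M1 \<Longrightarrow>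
      ereal (D * (R / r) powr \<alpha>) \<le> ereal_of_enat (M1.cover_num r (M1.mcball x R))"
    by (rule M1.lower_exponentE) blast
  obtain x where x: "x \<in> M1" using assms(3) by auto
  have "ereal_of_enat (M2.cover_num r (M2.mcball y R))
      \<le> ereal (C * 4 powr \<gamma> / D * (R / r) powr (\<gamma> - \<alpha>))"
    if r: "0 < r" "r < R" "R \<le> min \<rho> \<sigma>" and y: "y \<in> M2" for r R y
  proof -
    define a where "a = D * (R / r) powr \<alpha>"
    have a: "a > 0" using D r by (simp add: a_def)
    have "ereal a * ereal_of_enat (M2.cover_num r (M2.mcball y R))
        \<le> ereal_of_enat (M1.cover_num r (M1.mcball x R)) * ereal_of_enat (M2.cover_num r (M2.mcball y R))"
      unfolding a_def using r x by (intro ereal_mult_right_mono X) (auto simp: ereal_of_enat_nonneg)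
    also have "\<dots> \<le> ereal_of_enat (maxprod.cover_num (r / 4) (maxprod.mcball (x, y) R))"
      using cover_num_mcball_ge[of "r / 4"] r by simp
    also have "\<dots> \<le> ereal (C * (R / (r / 4)) powr \<gamma>)"
      using r x y by (intro XY) auto
    also have "R / (r / 4) = 4 * (R / r)" by simp
    also have "C * (4 * (R / r)) powr \<gamma> = C * 4 powr \<gamma> * (R / r) powr \<gamma>"
      using r by (simp only: powr_mult mult.assoc)
    finally have "ereal_of_enat (M2.cover_num r (M2.mcball y R)) \<le> ereal (C * 4 powr \<gamma> * (R / r) powr \<gamma> / a)"
      using a by (cases "M2.cover_num r (M2.mcball y R)") (auto simp: pos_le_divide_eq mult.commute)
    then show ?thesis
      by (simp add: a_def powr_diff)
  qed
  then show ?thesis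
    unfolding M2.assouad_exponent_def using C D
    by (intro exI[of _ "C * 4 powr \<gamma> / D"] exI[of _ "min \<rho> \<sigma>"] conjI allI impI ballI) auto
qed

lemma assouad_exponent_add:
  assumes "M1.assouad_exponent \<alpha>" "M2.assouad_exponent \<beta>"
  shows "maxprod.assouad_exponent (\<alpha> + \<beta>)"
proof -
  from assms(1) obtain C \<rho> where C: "C > 0" "\<rho> > 0"
    and X: "\<And>r R x. 0 < r \<Longrightarrow> r < R \<Longrightarrow> R \<le> \<rho> \<Longrightarrow> x \<in> M1 \<Longrightarrow>
      ereal_of_enat (M1.cover_num r (M1.mcball x R)) \<le> ereal (C * (R / r) powr \<alpha>)"
    by (rule M1.assouad_exponentE) blast
  from assms(2) obtain D \<sigma> where D: "D > 0" "\<sigma> > 0"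
    and Y: "\<And>r R y. 0 < r \<Longrightarrow> r < R \<Longrightarrow> R \<le> \<sigma> \<Longrightarrow> y \<in> M2 \<Longrightarrow>
      ereal_of_enat (M2.cover_num r (M2.mcball y R)) \<le> ereal (D * (R / r) powr \<beta>)"
    by (rule M2.assouad_exponentE) blast
  have "ereal_of_enat (maxprod.cover_num r (maxprod.mcball z R))
      \<le> ereal (C * D * (R / r) powr (\<alpha> + \<beta>))"
    if r: "0 < r" "r < R" "R \<le> min \<rho> \<sigma>" and z_in: "z \<in> M1 \<times> M2" for r R z
  proof -
    obtain x y where z: "z = (x, y)" "x \<in> M1" "y \<in> M2" using z_in by (cases z) auto
    have "ereal_of_enat (maxprod.cover_num r (maxprod.mcball z R))
        \<le> ereal_of_enat (M1.cover_num r (M1.mcball x R)) * ereal_of_enat (M2.cover_num r (M2.mcball y R))"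
      unfolding z(1) using r z by (intro cover_num_mcball_le) auto
    also have "\<dots> \<le> ereal (C * (R / r) powr \<alpha>) * ereal (D * (R / r) powr \<beta>)"
      using r z C D by (intro ereal_mult_mono X Y) (auto simp: ereal_of_enat_nonneg)
    also have "\<dots> = ereal (C * D * (R / r) powr (\<alpha> + \<beta>))"
      by (simp add: powr_add)
    finally show ?thesis .
  qed
  then show ?thesis
    unfolding maxprod.assouad_exponent_def using C D
    by (intro exI[of _ "C * D"] exI[of _ "min \<rho> \<sigma>"] conjI allI impI ballI) auto
qed

theorem dim_product_inequalities:
  assumes "M1 \<noteq> {}" "M2 \<noteq> {}"
  shows "M1.lower_dim M1 + M2.lower_dim M2 \<le> maxprod.lower_dim (M1 \<times> M2)"
    and "maxprod.lower_dim (M1 \<times> M2) \<le> M1.lower_dim M1 + M2.assouad_dim M2"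
    and "M1.lower_dim M1 + M2.assouad_dim M2 \<le> maxprod.assouad_dim (M1 \<times> M2)"
    and "maxprod.assouad_dim (M1 \<times> M2) \<le> M1.assouad_dim M1 + M2.assouad_dim M2"
proof -
  have ne: "M1 \<times> M2 \<noteq> {}" using assms by auto
  note dims = M1.lower_dim_eq M2.lower_dim_eq maxprod.lower_dim_eq
    M1.assouad_dim_eq[OF assms(1)] M2.assouad_dim_eq[OF assms(2)] maxprod.assouad_dim_eq[OF ne]
  note nonneg = M1.assouad_exponent_nonneg[OF _ assms(1)] M2.assouad_exponent_nonneg[OF _ assms(2)]
  show "M1.lower_dim M1 + M2.lower_dim M2 \<le> maxprod.lower_dim (M1 \<times> M2)"
    unfolding dims by (rule Sup_add_Sup_le)
      (auto simp: M1.lower_exponent_0 M2.lower_exponent_0 intro: lower_exponent_add)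
  show "maxprod.lower_dim (M1 \<times> M2) \<le> M1.lower_dim M1 + M2.assouad_dim M2"
    unfolding dims by (rule Sup_le_Sup_add_Inf)
      (use assms in \<open>auto simp: M1.lower_exponent_0 intro: lower_exponent_diff\<close>)
  show "M1.lower_dim M1 + M2.assouad_dim M2 \<le> maxprod.assouad_dim (M1 \<times> M2)"
    unfolding dims by (rule Sup_add_Inf_le_Inf)
      (use assms in \<open>auto simp: M1.lower_exponent_0 nonneg intro: assouad_exponent_diff\<close>)
  show "maxprod.assouad_dim (M1 \<times> M2) \<le> M1.assouad_dim M1 + M2.assouad_dim M2"
    unfolding dims by (rule Inf_le_Inf_add_Inf) (auto simp: nonneg intro: assouad_exponent_add)
qed

end

section \<open>Powers of a space\<close>

locale Metric_space_power = Metric_space M d for M :: "'a set" and d +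
  fixes n :: nat
  assumes n_ge_1: "1 \<le> n"

sublocale Metric_space_power \<subseteq> pow: Metric_space "mpow M n" "pow_dist d n"
  using Metric_space_pow_dist[OF Metric_space_axioms n_ge_1] .

context Metric_space_power
begin

lemma pow_dist_le_iff: "pow_dist d n f g \<le> c \<longleftrightarrow> (\<forall>i<n. d (f i) (g i) \<le> c)"
proof -
  have "{..<n} \<noteq> {}" using n_ge_1 by (auto simp: lessThan_empty_iff)
  then show ?thesis by (auto simp: pow_dist_def)
qed

lemma pow_dist_less_iff: "pow_dist d n f g < c \<longleftrightarrow> (\<forall>i<n. d (f i) (g i) < c)"
proof -
  have "{..<n} \<noteq> {}" using n_ge_1 by (auto simp: lessThan_empty_iff)
  then show ?thesis by (auto simp: pow_dist_def)
qed

lemma mem_mpow_iff: "f \<in> mpow M n \<longleftrightarrow> (\<forall>i<n. f i \<in> M) \<and> f \<in> extensional {..<n}"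
  by (auto simp: mpow_def PiE_iff)

lemma mcball_pow_dist:
  assumes "f \<in> mpow M n"
  shows "pow.mcball f R = (\<Pi>\<^sub>E i\<in>{..<n}. mcball (f i) R)"
  using assms by (auto simp: pow_dist_le_iff mem_mpow_iff PiE_iff extensional_def)

lemma openin_pow_dist_PiE:
  assumes U: "\<And>i. i < n \<Longrightarrow> openin mtopology (U i)"
  shows "openin pow.mtopology (\<Pi>\<^sub>E i\<in>{..<n}. U i)"
  unfolding pow.openin_mtopology
proof (intro conjI allI impI)
  show "(\<Pi>\<^sub>E i\<in>{..<n}. U i) \<subseteq> mpow M n"
    unfolding mpow_def using U openin_mtopology by (intro PiE_mono) auto
  fix f assume f: "f \<in> (\<Pi>\<^sub>E i\<in>{..<n}. U i)"
  have "\<exists>r>0. mball (f i) r \<subseteq> U i" if "i < n" for i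
    using U[OF that] f that unfolding openin_mtopology by (auto simp: PiE_iff)
  then obtain r where r: "\<And>i. i < n \<Longrightarrow> r i > 0 \<and> mball (f i) (r i) \<subseteq> U i"
    by metis
  define s where "s = Min (r ` {..<n})"
  have ne: "{..<n} \<noteq> {}" using n_ge_1 by (auto simp: lessThan_empty_iff)
  then have "s > 0" using r by (auto simp: s_def)
  moreover have "pow.mball f s \<subseteq> (\<Pi>\<^sub>E i\<in>{..<n}. U i)"
  proof
    fix g assume g: "g \<in> pow.mball f s"
    have "g i \<in> U i" if i: "i < n" for i
    proof -
      have "d (f i) (g i) < s" using g i by (auto simp: pow_dist_less_iff)
      also have "s \<le> r i" using i by (auto simp: s_def)
      finally have "g i \<in> mball (f i) (r i)"
        using g i by (auto simp: mem_mpow_iff)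
      then show ?thesis using r[OF i] by auto
    qed
    then show "g \<in> (\<Pi>\<^sub>E i\<in>{..<n}. U i)"
      using g by (auto simp: mem_mpow_iff PiE_iff)
  qed
  ultimately show "\<exists>r>0. pow.mball f r \<subseteq> (\<Pi>\<^sub>E i\<in>{..<n}. U i)" by blast
qed

lemma cover_num_PiE_le:
  assumes "0 \<le> r" "cover_num r F \<le> enat k"
  shows "pow.cover_num r (\<Pi>\<^sub>E i\<in>{..<n}. F) \<le> enat (k ^ n)"
proof -
  obtain \<U> where \<U>: "fine_cover r F \<U>" "card \<U> \<le> k"
    using cover_num_le_iff[OF assms(1)] assms(2) by auto
  let ?I = "\<Pi>\<^sub>E i\<in>{..<n}. \<U>" and ?\<W> = "(\<lambda>U. \<Pi>\<^sub>E i\<in>{..<n}. U i) ` (\<Pi>\<^sub>E i\<in>{..<n}. \<U>)"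
  have fin: "finite ?I"
    using \<U> by (auto simp: fine_cover_def intro: finite_PiE)
  have "pow.fine_cover r (\<Pi>\<^sub>E i\<in>{..<n}. F) ?\<W>"
    unfolding pow.fine_cover_def
  proof (intro conjI ballI)
    show "finite ?\<W>" using fin by simp
    show "(\<Pi>\<^sub>E i\<in>{..<n}. F) \<subseteq> \<Union>?\<W>"
    proof
      fix f assume f: "f \<in> (\<Pi>\<^sub>E i\<in>{..<n}. F)"
      have "\<exists>U\<in>\<U>. f i \<in> U" if "i < n" for i
        using f \<U> that by (auto simp: fine_cover_def PiE_iff)
      then obtain U where U: "\<And>i. i < n \<Longrightarrow> U i \<in> \<U> \<and> f i \<in> U i" by metis
      have "restrict U {..<n} \<in> ?I" using U by auto
      moreover have "f \<in> (\<Pi>\<^sub>E i\<in>{..<n}. restrict U {..<n} i)"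
        using U f by (auto simp: PiE_iff)
      ultimately show "f \<in> \<Union>?\<W>" by blast
    qed
  next
    fix W assume "W \<in> ?\<W>"
    then obtain U where U: "\<And>i. i < n \<Longrightarrow> U i \<in> \<U>" "W = (\<Pi>\<^sub>E i\<in>{..<n}. U i)"
      by (auto simp: PiE_iff)
    show "openin pow.mtopology W"
      unfolding U(2) using U(1) \<U>(1) by (intro openin_pow_dist_PiE) (auto simp: fine_cover_def)
    fix f g assume "f \<in> W" "g \<in> W"
    then show "pow_dist d n f g \<le> r"
      using U \<U>(1) by (force simp: pow_dist_le_iff fine_cover_def PiE_iff)
  qed
  moreover have "card ?\<W> \<le> k ^ n"
  proof -
    have "card ?\<W> \<le> card ?I" using fin by (rule card_image_le)
    also have "\<dots> \<le> k ^ n" using \<U>(2) by (simp add: card_PiE power_mono)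
    finally show ?thesis .
  qed
  ultimately show ?thesis
    using pow.cover_num_le_iff[OF assms(1)] by blast
qed

text \<open>
  The number \<open>k\<close> is the same for all coordinates although the sets differ, which is what a
  bound uniform over all centres provides.
\<close>
lemma cover_num_PiE_ge:
  assumes "0 < r" "\<And>i. i < n \<Longrightarrow> F i \<subseteq> M" "\<And>i. i < n \<Longrightarrow> enat k \<le> cover_num (4 * r) (F i)"
  shows "enat (k ^ n) \<le> pow.cover_num r (\<Pi>\<^sub>E i\<in>{..<n}. F i)"
proof -
  have "\<exists>S\<subseteq>F i. finite S \<and> card S = k \<and> separated r S" if "i < n" for i
    using separated_subset_exists assms that by blast
  then obtain S where S: "\<And>i. i < n \<Longrightarrow> S i \<subseteq> F i \<and> finite (S i) \<and> card (S i) = k \<and> separated r (S i)"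
    by metis
  have "pow.separated r (\<Pi>\<^sub>E i\<in>{..<n}. S i)"
    unfolding pow.separated_def
  proof (intro ballI impI)
    fix f g assume fg: "f \<in> (\<Pi>\<^sub>E i\<in>{..<n}. S i)" "g \<in> (\<Pi>\<^sub>E i\<in>{..<n}. S i)" "f \<noteq> g"
    then obtain i where i: "i < n" "f i \<noteq> g i"
      by (metis PiE_ext lessThan_iff)
    then have "r < d (f i) (g i)"
      using S[OF i(1)] fg by (auto simp: separated_def PiE_iff)
    then show "r < pow_dist d n f g"
      using i pow_dist_le_iff[of f g r] by (auto simp: not_le[symmetric])
  qed
  moreover have "(\<Pi>\<^sub>E i\<in>{..<n}. S i) \<subseteq> (\<Pi>\<^sub>E i\<in>{..<n}. F i)"
    using S by (intro PiE_mono) auto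
  moreover have "finite (\<Pi>\<^sub>E i\<in>{..<n}. S i)" "card (\<Pi>\<^sub>E i\<in>{..<n}. S i) = k ^ n"
    using S by (auto simp: card_PiE intro: finite_PiE)
  ultimately show ?thesis
    using pow.card_separated_le_cover_num[of r "\<Pi>\<^sub>E i\<in>{..<n}. S i"] assms(1) by auto
qed

lemma lower_exponent_pow:
  assumes "lower_exponent \<alpha>"
  shows "pow.lower_exponent (real n * \<alpha>)"
proof -
  from assms obtain C \<rho> where C: "C > 0" "\<rho> > 0"
    and X: "\<And>r R x. 0 < r \<Longrightarrow> r < R \<Longrightarrow> R \<le> \<rho> \<Longrightarrow> x \<in> M \<Longrightarrow>
      ereal (C * (R / r) powr \<alpha>) \<le> ereal_of_enat (cover_num r (mcball x R))"
    by (rule lower_exponentE) blast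
  show ?thesis
  proof (rule pow.lower_exponentI_scaled)
    show "C ^ n > 0" "\<rho> > 0" using C by auto
    fix r R f assume r: "0 < r" "4 * r < R" "R \<le> \<rho>" and f: "f \<in> mpow M n"
    \<comment> \<open>Separated sets have integer size, so the real bound \<open>c\<close> is rounded up before taking powers.\<close>
    define c where "c = C * (R / (4 * r)) powr \<alpha>"
    have "c > 0" using C r by (simp add: c_def)
    have "enat (nat \<lceil>c\<rceil>) \<le> cover_num (4 * r) (mcball (f i) R)" if "i < n" for i
      using X[of "4 * r" R "f i"] r f that
      by (auto simp: c_def ereal_le_of_enat_iff mpow_def PiE_iff)
    then have k: "enat (nat \<lceil>c\<rceil> ^ n) \<le> pow.cover_num r (pow.mcball f R)"
      unfolding mcball_pow_dist[OF f] using r by (intro cover_num_PiE_ge) auto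
    have "C ^ n * (R / (4 * r)) powr (real n * \<alpha>) = c ^ n"
      using r by (simp add: c_def power_mult_distrib powr_power mult.commute)
    also have "\<dots> \<le> real (nat \<lceil>c\<rceil>) ^ n"
      using \<open>c > 0\<close> by (intro power_mono) (auto simp: real_nat_ceiling_ge)
    finally have "ereal (C ^ n * (R / (4 * r)) powr (real n * \<alpha>)) \<le> ereal_of_enat (enat (nat \<lceil>c\<rceil> ^ n))"
      by simp
    also have "\<dots> \<le> ereal_of_enat (pow.cover_num r (pow.mcball f R))"
      using k by (simp only: ereal_of_enat_le_iff)
    finally show "ereal (C ^ n * (R / (4 * r)) powr (real n * \<alpha>))
      \<le> ereal_of_enat (pow.cover_num r (pow.mcball f R))" .
  qed
qed

text \<open>
  Only balls around constant functions are used: they are the powers of the balls of \<open>M\<close>, so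
  that \<open>N\<^sub>r(B(x,R))\<^sup>n\<close> bounds their covering number and an \<open>n\<close>-th root gives the exponent.
\<close>
lemma lower_exponent_of_pow:
  assumes "pow.lower_exponent \<gamma>"
  shows "lower_exponent (\<gamma> / real n)"
proof -
  from assms obtain C \<rho> where C: "C > 0" "\<rho> > 0"
    and P: "\<And>r R f. 0 < r \<Longrightarrow> r < R \<Longrightarrow> R \<le> \<rho> \<Longrightarrow> f \<in> mpow M n \<Longrightarrow>
      ereal (C * (R / r) powr \<gamma>) \<le> ereal_of_enat (pow.cover_num r (pow.mcball f R))"
    by (rule pow.lower_exponentE) blast
  have "ereal (C powr (1 / n) * (R / r) powr (\<gamma> / n)) \<le> ereal_of_enat (cover_num r (mcball x R))"
    if r: "0 < r" "r < R" "R \<le> \<rho>" and x: "x \<in> M" for r R x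
  proof (cases "cover_num r (mcball x R)")
    case (enat k)
    let ?f = "\<lambda>i\<in>{..<n}. x"
    have f: "?f \<in> mpow M n" using x by (auto simp: mpow_def)
    have ball: "pow.mcball ?f R = (\<Pi>\<^sub>E i\<in>{..<n}. mcball x R)"
      unfolding mcball_pow_dist[OF f] by (intro PiE_cong) auto
    have "ereal (C * (R / r) powr \<gamma>) \<le> ereal_of_enat (pow.cover_num r (\<Pi>\<^sub>E i\<in>{..<n}. mcball x R))"
      using P[OF r f] by (simp only: ball)
    also have "\<dots> \<le> ereal_of_enat (enat (k ^ n))"
      using cover_num_PiE_le[of r "mcball x R" k] enat r by (simp only: ereal_of_enat_le_iff)
    finally have "C * (R / r) powr \<gamma> \<le> real k ^ n" by simp
    moreover have "(C powr (1 / n) * (R / r) powr (\<gamma> / n)) ^ n = C * (R / r) powr \<gamma>"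
      using n_ge_1 C r by (simp add: power_mult_distrib powr_power)
    ultimately have "(C powr (1 / n) * (R / r) powr (\<gamma> / n)) ^ n \<le> real k ^ n"
      by simp
    then have "C powr (1 / n) * (R / r) powr (\<gamma> / n) \<le> real k"
      by (rule iffD1[OF power_mono_iff, rotated -1]) (use n_ge_1 C in auto)
    then show ?thesis using enat by simp
  qed simp
  then show ?thesis
    unfolding lower_exponent_def using C
    by (intro exI[of _ "C powr (1 / n)"] exI[of _ \<rho>] conjI allI impI ballI) auto
qed

theorem lower_dim_pow: "pow.lower_dim (mpow M n) = ereal (real n) * lower_dim M"
  unfolding lower_dim_eq pow.lower_dim_eq
  by (rule Sup_eq_mult_Sup) (use n_ge_1 in \<open>auto intro: lower_exponent_pow lower_exponent_of_pow\<close>)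

end

section \<open>Dimension inequalities\<close>

theorem theorem2p1:
  fixes X :: "'a set" and dX :: "'a \<Rightarrow> 'a \<Rightarrow> real"
    and Y :: "'b set" and dY :: "'b \<Rightarrow> 'b \<Rightarrow> real"
  assumes "Metric_space X dX" and "X \<noteq> {}"
    and "Metric_space Y dY" and "Y \<noteq> {}"
  shows "Metric_space.lower_dim X dX X + Metric_space.lower_dim Y dY Y
           \<le> Metric_space.lower_dim (X \<times> Y) (max_dist dX dY) (X \<times> Y)
         \<and> Metric_space.lower_dim (X \<times> Y) (max_dist dX dY) (X \<times> Y)
           \<le> Metric_space.lower_dim X dX X + Metric_space.assouad_dim Y dY Y
         \<and> Metric_space.lower_dim X dX X + Metric_space.assouad_dim Y dY Y
           \<le> Metric_space.assouad_dim (X \<times> Y) (max_dist dX dY) (X \<times> Y)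
         \<and> Metric_space.assouad_dim (X \<times> Y) (max_dist dX dY) (X \<times> Y)
           \<le> Metric_space.assouad_dim X dX X + Metric_space.assouad_dim Y dY Y
         \<and> (\<forall>n\<ge>(1::nat). Metric_space.lower_dim (mpow X n) (pow_dist dX n) (mpow X n)
           = ereal (real n) * Metric_space.lower_dim X dX X)"
proof -
  interpret Metric_space12 X dX Y dY
    using assms by (simp add: Metric_space12_def)
  have "Metric_space.lower_dim (mpow X n) (pow_dist dX n) (mpow X n)
      = ereal (real n) * Metric_space.lower_dim X dX X" if "n \<ge> 1" for n
  proof -
    interpret Metric_space_power X dX n
      using that by unfold_locales
    show ?thesis by (rule lower_dim_pow)
  qed
  then show ?thesis
    using dim_product_inequalities[OF assms(2,4)] by blast
qed

end
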